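(* Let $\omega$ be a probability distribution on the open interval $(0,1)$ with $\mu:=\int_0^1|\log(1-x)|\,\omega(\mathrm{d}x)<\infty$. Let $n_0\ge 1$ be an integer and let $(a_n)_{n\ge 0}$ be any real sequence satisfying $$a_n=1+\sum_{m=1}^{n}q(n,m)\,a_{n-m}\qquad\text{for all } n\ge n_0 .$$ Then $a_n\sim \dfrac{\log n}{\mu}$ as $n\to\infty$. In particular, this holds for the sequence $a_n=\mathbb{E}K_n$, which is the unique sequence satisfying the recursion for all $n>0$ with boundary value $a_0=0$.
   Context: For a probability distribution $\omega$ on $(0,1)$ set, for $n\ge 1$, $$w(n,m)=\binom{n}{m}\int_0^1x^m(1-x)^{n-m}\,\omega(\mathrm{d}x)\ (0\le m\le n),\qquad W(n)=1-w(n,0),\qquad q(n,m)=\frac{w(n,m)}{W(n)}\ (1\le m\le n).$$ Definition of $K_n$: let $X_1,X_2,\ldots$ be i.i.d. with distribution $\omega$, and let $U_1,U_2,\ldots$ be i.i.d. uniform on $[0,1]$, independent of $(X_j)$. Put $P_0=0$ and $P_j=1-\prod_{i=1}^j(1-X_i)$. Then $K_n$ is the number of $j\ge1$ such that the interval $(P_{j-1},P_j)$ contains at least one of $U_1,\ldots,U_n$; $K_0=0$. (Recording the nonzero numbers of points in these intervals from left to right gives the random composition $C_n$ of $n$, and $K_n$ is its number of parts.) *)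

theory Defs
  imports "HOL-Probability.Probability"
begin

definition decr_w :: "real measure \<Rightarrow> nat \<Rightarrow> nat \<Rightarrow> real" where
  "decr_w \<omega> n m = real (n choose m) * (LINT x|\<omega>. x ^ m * (1 - x) ^ (n - m))"

definition decr_W :: "real measure \<Rightarrow> nat \<Rightarrow> real" where
  "decr_W \<omega> n = 1 - decr_w \<omega> n 0"

definition decr_q :: "real measure \<Rightarrow> nat \<Rightarrow> nat \<Rightarrow> real" where
  "decr_q \<omega> n m = decr_w \<omega> n m / decr_W \<omega> n"

definition log_mean :: "real measure \<Rightarrow> real" where
  "log_mean \<omega> = (LINT x|\<omega>. \<bar>ln (1 - x)\<bar>)"

text \<open>Only the variables \<open>X j\<close> and \<open>U i\<close> with \<open>i, j \<ge> 1\<close> matter. Independence is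
  that of the whole family, so the sequences \<open>X\<close> and \<open>U\<close> are also independent of each other.\<close>

definition stick_model ::
  "real measure \<Rightarrow> 'b measure \<Rightarrow> (nat \<Rightarrow> 'b \<Rightarrow> real) \<Rightarrow> (nat \<Rightarrow> 'b \<Rightarrow> real) \<Rightarrow> bool" where
  "stick_model \<omega> M X U \<longleftrightarrow>
     prob_space M \<and>
     prob_space.indep_vars M (\<lambda>_. borel) (case_sum X U) ({1..} <+> {1..}) \<and>
     (\<forall>j\<ge>1. distr M borel (X j) = \<omega>) \<and>
     (\<forall>i\<ge>1. distr M borel (U i) = uniform_measure lborel {0..1})"

definition stick_P :: "(nat \<Rightarrow> 'b \<Rightarrow> real) \<Rightarrow> nat \<Rightarrow> 'b \<Rightarrow> real" where
  "stick_P X j s = 1 - (\<Prod>i=1..j. 1 - X i s)"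

text \<open>The set counted here is almost surely finite: almost surely \<open>X j s\<close> lies in \<open>(0,1)\<close> for
  all \<open>j \<ge> 1\<close>, so the intervals are disjoint and at most \<open>n\<close> of them are hit.\<close>

definition stick_K :: "(nat \<Rightarrow> 'b \<Rightarrow> real) \<Rightarrow> (nat \<Rightarrow> 'b \<Rightarrow> real) \<Rightarrow> nat \<Rightarrow> 'b \<Rightarrow> nat" where
  "stick_K X U n s =
     card {j. 1 \<le> j \<and> (\<exists>i\<in>{1..n}. U i s \<in> {stick_P X (j - 1) s <..< stick_P X j s})}"

lemma stick_model_exists:
  assumes "prob_space \<omega>" and "sets \<omega> = sets borel"
  shows "\<exists>(M :: (nat + nat \<Rightarrow> real) measure) X U. stick_model \<omega> M X U"
proof -
  define u :: "real measure" where "u = uniform_measure lborel {0..1}"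
  define D :: "nat + nat \<Rightarrow> real measure" where "D = case_sum (\<lambda>_. \<omega>) (\<lambda>_. u)"
  define M where "M = PiM UNIV D"
  define X :: "nat \<Rightarrow> (nat + nat \<Rightarrow> real) \<Rightarrow> real" where "X = (\<lambda>j f. f (Inl j))"
  define U :: "nat \<Rightarrow> (nat + nat \<Rightarrow> real) \<Rightarrow> real" where "U = (\<lambda>j f. f (Inr j))"
  have u: "prob_space u" unfolding u_def by (rule prob_space_uniform_measure) auto
  have D: "prob_space (D k)" for k using assms(1) u by (auto simp: D_def split: sum.split)
  have sD: "sets (D k) = sets borel" for k
    using assms(2) by (auto simp: D_def u_def split: sum.split)
  have M: "prob_space M" unfolding M_def using D by (rule prob_space_PiM)
  then interpret prob_space M .
  have comp: "distr M borel (\<lambda>f. f k) = D k" for k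
  proof -
    have "distr M borel (\<lambda>f. f k) = distr M (D k) (\<lambda>f. f k)"
      by (rule distr_cong) (auto simp: sD)
    also have "\<dots> = D k" unfolding M_def by (rule distr_PiM_component) (auto simp: D)
    finally show ?thesis .
  qed
  have meas: "random_variable borel (\<lambda>f. f k)" for k
  proof -
    have "(\<lambda>f. f k) \<in> measurable M (D k)"
      unfolding M_def by (rule measurable_component_singleton) simp
    then show ?thesis
      by (subst (asm) measurable_cong_sets[OF refl sD])
  qed
  have ind: "indep_vars (\<lambda>_. borel) (\<lambda>k f. f k) (UNIV :: (nat + nat) set)"
  proof (rule indep_vars_iff_distr_eq_PiM'[THEN iffD2])
    have "sets (PiM UNIV (\<lambda>_. borel)) = sets M"
      unfolding M_def by (rule sets_PiM_cong) (simp_all add: sD)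
    then have "distr M (PiM UNIV (\<lambda>_. borel)) (\<lambda>f. \<lambda>k\<in>UNIV. f k) = distr M M (\<lambda>f. f)"
      by (intro distr_cong) (simp_all add: restrict_def)
    also have "\<dots> = M" by (rule distr_id)
    finally show "distr M (PiM UNIV (\<lambda>_. borel)) (\<lambda>f. \<lambda>k\<in>UNIV. f k) =
      PiM UNIV (\<lambda>k. distr M borel (\<lambda>f. f k))" by (simp add: comp) (simp add: M_def)
  qed (simp, rule meas)
  have eq: "case_sum X U = (\<lambda>k f. f k)"
    by (auto simp: X_def U_def fun_eq_iff split: sum.split)
  have "stick_model \<omega> M X U"
    unfolding stick_model_def eq
    using M indep_vars_subset[OF ind subset_UNIV] comp
    by (simp add: X_def U_def D_def u_def)
  then show ?thesis by blast
qed

end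

theory Submission
  imports Defs
begin

text \<open>
  The recursion is diagonalised by the binomial transform. Call \<open>f\<close> the transform of \<open>r\<close> when
  \<open>f n = (\<Sum>k=1..n. (-1) ^ (k + 1) * (n choose k) * r k)\<close>. If every one of \<open>n\<close> points is
  removed with probability \<open>x\<close>, independently of the others, then a given set of \<open>k\<close> points survives
  with probability \<open>(1 - x) ^ k\<close>; so the mean of \<open>f\<close> at the number of surviving points is the
  transform of \<open>(1 - x) ^ k * r k\<close>. Averaged over \<open>\<omega>\<close>, the operator given by the weights
  \<open>decr_w \<omega> n m\<close> multiplies \<open>r k\<close> by the moment \<open>\<integral> (1 - x) ^ k \<omega>(dx)\<close>
  (lemma \<open>decr_w_binomial_transform\<close>). Both halves of the theorem come from this one fact.

  \<^emph>\<open>Asymptotics.\<close> The harmonic numbers are the transform of \<open>1 / k\<close>. Hence their drift under the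
  recursion is explicit:
  \<open>harm n - (\<Sum>m=1..n. decr_q \<omega> n m * harm (n - m))\<close> equals
  \<open>\<integral> (\<Sum>k=1..n. x ^ k / k) \<omega>(dx)\<close> divided by \<open>decr_W \<omega> n\<close>, and this tends to
  \<open>\<integral> \<bar>ln (1 - x)\<bar> \<omega>(dx) = \<mu>\<close> by dominated convergence (lemma \<open>harm_drift_tendsto\<close>). So
  \<open>c * harm n\<close> has drift above 1 for all large \<open>n\<close> if \<open>c > 1 / \<mu>\<close>, and below 1 if \<open>c < 1 / \<mu>\<close>,
  whereas a solution \<open>a\<close> of the recursion has drift exactly 1. Since the numbers \<open>decr_q \<omega> n m\<close>
  with \<open>1 \<le> m \<le> n\<close> are probabilities, a maximum principle (lemma \<open>subharmonic_bounded_above\<close>)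
  turns the comparison of drifts into \<open>a n \<le> c * harm n + C\<close> and \<open>a n \<ge> c * harm n - C\<close>
  respectively. As \<open>harm n\<close> is asymptotic to \<open>ln n\<close>, this gives the claim; arbitrary initial values
  only affect \<open>C\<close>.

  \<^emph>\<open>The mean number of parts.\<close> Given the sticks, the \<open>j\<close>-th interval, of length \<open>L\<close>, is missed by
  all \<open>n\<close> uniform points with probability \<open>(1 - L) ^ n\<close>, and \<open>1 - (1 - L) ^ n\<close> is the transform of
  the powers of \<open>L\<close>. The moments of
  \<open>L = X j * (\<Prod>i=1..j-1. 1 - X i)\<close> factor by independence into a geometric sequence in \<open>j\<close>.
  Summing over \<open>j\<close> shows that the mean of \<open>stick_K\<close> is the transform of
  \<open>(\<integral> x ^ k \<omega>(dx)) / (1 - \<integral> (1 - x) ^ k \<omega>(dx))\<close> (lemma \<open>expectation_stick_K\<close>), and for that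
  sequence the recursion is checked coefficient by coefficient (lemma \<open>mean_parts_recursion\<close>).
\<close>

section \<open>The binomial transform and harmonic numbers\<close>

definition binomial_transform :: "(nat \<Rightarrow> real) \<Rightarrow> nat \<Rightarrow> real" where
  "binomial_transform r n = (\<Sum>k=1..n. (-1) ^ (k + 1) * real (n choose k) * r k)"

text \<open>The sum may run to any common bound, because the extra binomial coefficients vanish. This
  is what makes transforms at different arguments comparable term by term.\<close>
lemma binomial_transform_extend:
  assumes "n \<le> N"
  shows "binomial_transform r n = (\<Sum>k=1..N. (-1) ^ (k + 1) * real (n choose k) * r k)"
  unfolding binomial_transform_def
  by (rule sum.mono_neutral_left) (use assms in \<open>auto simp: binomial_eq_0\<close>)

lemma binomial_transform_power:
  "binomial_transform (\<lambda>k. y ^ k) n = 1 - (1 - y) ^ n"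
proof -
  have "(1 - y) ^ n = (- y + 1) ^ n"
    by simp
  also have "\<dots> = (\<Sum>k\<le>n. real (n choose k) * (- y) ^ k)"
    by (subst binomial_ring) simp
  also have "\<dots> = 1 + (\<Sum>k=1..n. real (n choose k) * (- y) ^ k)"
    by (simp add: sum.atLeast_Suc_atMost[of 0] flip: atLeast0AtMost)
  also have "(\<Sum>k=1..n. real (n choose k) * (- y) ^ k) = - binomial_transform (\<lambda>k. y ^ k) n"
    unfolding binomial_transform_def sum_negf[symmetric]
    by (intro sum.cong refl) (simp add: power_minus[of y])
  finally show ?thesis
    by simp
qed

text \<open>Induction on \<open>n\<close>: by Pascal's rule and the absorption identity
  \<open>(n choose (k - 1)) / k = (Suc n choose k) / Suc n\<close>, the increment of the left-hand side is
  \<open>1 / Suc n\<close> times the transform of \<open>y ^ k\<close> at \<open>Suc n\<close>. The case \<open>y = 1\<close> represents the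
  harmonic numbers as a transform.\<close>
lemma binomial_transform_power_div:
  "binomial_transform (\<lambda>k. y ^ k / real k) n = (\<Sum>k=1..n. (1 - (1 - y) ^ k) / real k)"
proof (induction n)
  case 0
  then show ?case
    by (simp add: binomial_transform_def)
next
  case (Suc n)
  have absorb: "real (Suc n choose k) * (z / real k)
      = real (n choose k) * (z / real k) + real (Suc n choose k) * z / real (Suc n)"
    if "k \<in> {1..Suc n}" for k z
  proof -
    obtain j where j: "k = Suc j"
      using \<open>k \<in> {1..Suc n}\<close> by (cases k) auto
    have "real (Suc j) * real (Suc n choose Suc j) = real (Suc n) * real (n choose j)"
      using Suc_times_binomial[of j n] by (metis of_nat_mult)
    then have "real (n choose j) * (z / real (Suc j)) = real (Suc n choose Suc j) * z / real (Suc n)"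
      by (simp add: frac_eq_eq mult.commute mult.left_commute del: binomial_Suc_Suc of_nat_Suc)
    moreover have "real (Suc n choose Suc j) * (z / real (Suc j))
        = real (n choose j) * (z / real (Suc j)) + real (n choose Suc j) * (z / real (Suc j))"
      by (simp only: binomial_Suc_Suc of_nat_add distrib_right)
    ultimately show ?thesis
      unfolding j by linarith
  qed
  have "binomial_transform (\<lambda>k. y ^ k / real k) (Suc n)
      = (\<Sum>k=1..Suc n. (-1) ^ (k + 1) * (real (n choose k) * (y ^ k / real k)
                        + real (Suc n choose k) * y ^ k / real (Suc n)))"
    unfolding binomial_transform_def
    by (intro sum.cong refl) (simp only: absorb mult.assoc)
  also have "\<dots> = (\<Sum>k=1..Suc n. (-1) ^ (k + 1) * real (n choose k) * (y ^ k / real k))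
      + (\<Sum>k=1..Suc n. (-1) ^ (k + 1) * real (Suc n choose k) * y ^ k) / real (Suc n)"
    by (simp only: sum.distrib sum_divide_distrib distrib_left mult.assoc times_divide_eq_right)
  also have "(\<Sum>k=1..Suc n. (-1) ^ (k + 1) * real (n choose k) * (y ^ k / real k))
      = binomial_transform (\<lambda>k. y ^ k / real k) n"
    by (rule binomial_transform_extend[symmetric]) simp
  also have "(\<Sum>k=1..Suc n. (-1) ^ (k + 1) * real (Suc n choose k) * y ^ k)
      = 1 - (1 - y) ^ Suc n"
    using binomial_transform_power[of y "Suc n"] by (simp add: binomial_transform_def)
  finally show ?case
    using Suc.IH by simp
qed

text \<open>The factorial moments of a binomial variable: choosing \<open>m\<close> removed points and then \<open>k\<close>
  of the survivors is the same as choosing the \<open>k\<close> points first and removing \<open>m\<close> of the others.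
  The number removed among these others is then summed out by the binomial theorem.\<close>
lemma binomial_thinning:
  fixes x :: real
  assumes "k \<le> n"
  shows "(\<Sum>m\<le>n. real (n choose m) * (x ^ m * (1 - x) ^ (n - m)) * real ((n - m) choose k))
    = real (n choose k) * (1 - x) ^ k"
proof -
  have "(\<Sum>m\<le>n. real (n choose m) * (x ^ m * (1 - x) ^ (n - m)) * real ((n - m) choose k))
      = (\<Sum>m\<le>n-k. real (n choose m) * (x ^ m * (1 - x) ^ (n - m)) * real ((n - m) choose k))"
    by (rule sum.mono_neutral_right) (auto simp: binomial_eq_0)
  also have "\<dots> = (\<Sum>m\<le>n-k. real (n choose k) * (1 - x) ^ k *
      (real ((n - k) choose m) * x ^ m * (1 - x) ^ (n - k - m)))"
  proof (rule sum.cong)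
    fix m assume "m \<in> {..n-k}"
    then have m: "m + k \<le> n"
      using assms by auto
    have "(n choose m) * ((n - m) choose k) = (n choose (n - m)) * ((n - m) choose k)"
      using m by (subst binomial_symmetric[of m n]) auto
    also have "\<dots> = (n choose k) * ((n - k) choose (n - m - k))"
      using m by (intro choose_mult) auto
    also have "(n - k) choose (n - m - k) = (n - k) choose m"
      using m binomial_symmetric[of m "n - k"] by (simp add: diff_right_commute add_le_imp_le_diff add.commute)
    finally have C: "real (n choose m) * real ((n - m) choose k)
        = real (n choose k) * real ((n - k) choose m)"
      by (metis of_nat_mult)
    have P: "(1 - x) ^ (n - m) = (1 - x) ^ k * (1 - x) ^ (n - k - m)"
      unfolding power_add[symmetric] using m by (intro arg_cong[where f="\<lambda>e. (1 - x) ^ e"]) auto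
    have "real (n choose m) * (x ^ m * (1 - x) ^ (n - m)) * real ((n - m) choose k)
        = (real (n choose m) * real ((n - m) choose k)) * (x ^ m * (1 - x) ^ (n - m))"
      by simp
    then show "real (n choose m) * (x ^ m * (1 - x) ^ (n - m)) * real ((n - m) choose k)
        = real (n choose k) * (1 - x) ^ k *
          (real ((n - k) choose m) * x ^ m * (1 - x) ^ (n - k - m))"
      unfolding C P by simp
  qed simp
  also have "\<dots> = real (n choose k) * (1 - x) ^ k * (x + (1 - x)) ^ (n - k)"
    unfolding sum_distrib_left[symmetric] by (subst binomial_ring) simp
  finally show ?thesis
    by simp
qed

text \<open>Removing points independently acts diagonally on transforms: term \<open>k\<close> is multiplied by
  the probability that \<open>k\<close> given points survive.\<close>
lemma binomial_transform_thinning: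
  "(\<Sum>m\<le>n. real (n choose m) * (x ^ m * (1 - x) ^ (n - m)) * binomial_transform r (n - m))
    = binomial_transform (\<lambda>k. (1 - x) ^ k * r k) n"
proof -
  have "(\<Sum>m\<le>n. real (n choose m) * (x ^ m * (1 - x) ^ (n - m)) * binomial_transform r (n - m))
    = (\<Sum>m\<le>n. \<Sum>k=1..n. (-1) ^ (k + 1) * r k *
        (real (n choose m) * (x ^ m * (1 - x) ^ (n - m)) * real ((n - m) choose k)))"
    by (intro sum.cong refl, subst binomial_transform_extend[of _ n])
       (auto simp: sum_distrib_left intro!: sum.cong)
  also have "\<dots> = (\<Sum>k=1..n. (-1) ^ (k + 1) * r k *
      (\<Sum>m\<le>n. real (n choose m) * (x ^ m * (1 - x) ^ (n - m)) * real ((n - m) choose k)))"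
    by (subst sum.swap) (simp add: sum_distrib_left)
  also have "\<dots> = binomial_transform (\<lambda>k. (1 - x) ^ k * r k) n"
    unfolding binomial_transform_def
    by (intro sum.cong refl, subst binomial_thinning) auto
  finally show ?thesis .
qed

lemma harm_over_ln_tendsto: "(\<lambda>n. harm n / ln (real n)) \<longlonglongrightarrow> 1"
proof -
  have "(\<lambda>n. (harm n - ln (real n)) / ln (real n) + 1) \<longlonglongrightarrow> 0 + 1"
    by (intro tendsto_add tendsto_const tendsto_divide_0[OF euler_mascheroni_LIMSEQ])
       (auto intro!: filterlim_at_top_imp_at_infinity filterlim_compose[OF ln_at_top] filterlim_real_sequentially)
  then have "(\<lambda>n. (harm n - ln (real n)) / ln (real n) + 1) \<longlonglongrightarrow> 1"
    by simp
  then show ?thesis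
    by (rule Lim_transform_eventually)
       (auto intro!: eventually_mono[OF eventually_gt_at_top[of 1]] simp: field_simps)
qed

section \<open>The recursion of a stick-breaking law\<close>

locale stick_law = prob_space \<omega> for \<omega> :: "real measure" +
  assumes sets_law [simp, measurable_cong]: "sets \<omega> = sets borel"
    and prob_unit: "prob {0<..<1} = 1"
    and integrable_log: "integrable \<omega> (\<lambda>x. \<bar>ln (1 - x)\<bar>)"
begin

lemma AE_unit: "AE x in \<omega>. 0 < x \<and> x < 1"
  using prob_unit by (subst (asm) prob_eq_1) auto

lemma integrable_beta [simp, intro]: "integrable \<omega> (\<lambda>x. x ^ m * (1 - x) ^ k)"
proof (rule integrable_const_bound)
  show "AE x in \<omega>. norm (x ^ m * (1 - x) ^ k) \<le> 1"
    using AE_unit by eventually_elim (auto simp: abs_mult power_abs intro!: mult_le_one power_le_one)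
qed measurable

lemma integrable_power [simp, intro]: "integrable \<omega> (\<lambda>x. x ^ m)"
  using integrable_beta[of m 0] by simp

lemma integrable_compl_power [simp, intro]: "integrable \<omega> (\<lambda>x. (1 - x) ^ k)"
  using integrable_beta[of 0 k] by simp

definition moment :: "nat \<Rightarrow> real" where
  "moment k = (LINT x|\<omega>. x ^ k)"

definition compl_moment :: "nat \<Rightarrow> real" where
  "compl_moment k = (LINT x|\<omega>. (1 - x) ^ k)"

lemma decr_w_0: "decr_w \<omega> n 0 = compl_moment n"
  by (simp add: decr_w_def compl_moment_def)

lemma decr_W_eq: "decr_W \<omega> n = 1 - compl_moment n"
  by (simp add: decr_W_def decr_w_0)

lemma integral_binomial_transform:
  assumes "\<And>k. integrable \<omega> (\<lambda>x. f x k)"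
  shows "(LINT x|\<omega>. binomial_transform (f x) n) = binomial_transform (\<lambda>k. LINT x|\<omega>. f x k) n"
  using assms unfolding binomial_transform_def by (subst Bochner_Integration.integral_sum) auto

lemma sum_decr_w: 
  "(\<Sum>m\<le>n. decr_w \<omega> n m * f m)
    = (LINT x|\<omega>. (\<Sum>m\<le>n. real (n choose m) * (x ^ m * (1 - x) ^ (n - m)) * f m))"
proof -
  have "integrable \<omega> (\<lambda>x. real (n choose m) * (x ^ m * (1 - x) ^ (n - m)) * f m)" for m
    by (intro integrable_mult_left integrable_mult_right integrable_beta)
  then show ?thesis
    unfolding decr_w_def by (subst Bochner_Integration.integral_sum) simp_all
qed

text \<open>The diagonal action of a single thinning, averaged over the random removal
  probability.\<close>
lemma decr_w_binomial_transform:
  "(\<Sum>m\<le>n. decr_w \<omega> n m * binomial_transform r (n - m))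
    = binomial_transform (\<lambda>k. compl_moment k * r k) n"
  unfolding sum_decr_w binomial_transform_thinning
  by (subst integral_binomial_transform) (auto simp: compl_moment_def)

lemma compl_moment_less_1: "k > 0 \<Longrightarrow> compl_moment k < 1"
proof -
  assume "k > 0"
  have "compl_moment k < (LINT x|\<omega>. 1)"
    unfolding compl_moment_def
  proof (rule integral_less_AE_space)
    show "AE x in \<omega>. (1 - x) ^ k < 1"
      using AE_unit by eventually_elim (use \<open>k > 0\<close> in \<open>auto intro!: power_Suc_less_one simp: power_less_one_iff\<close>)
  qed (auto simp: emeasure_space_1)
  then show ?thesis
    by (simp add: prob_space)
qed

lemma compl_moment_nonneg: "compl_moment k \<ge> 0"
  unfolding compl_moment_def
  by (rule integral_nonneg_AE) (use AE_unit in eventually_elim, auto)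

lemma decr_W_pos: "n > 0 \<Longrightarrow> decr_W \<omega> n > 0"
  using compl_moment_less_1 by (simp add: decr_W_eq)

lemma decr_q_nonneg: "decr_q \<omega> n m \<ge> 0"
proof -
  have "decr_w \<omega> n m \<ge> 0"
    unfolding decr_w_def
    by (intro mult_nonneg_nonneg integral_nonneg_AE of_nat_0_le_iff) (use AE_unit in eventually_elim, auto)
  moreover have "decr_W \<omega> n \<ge> 0"
    using decr_W_pos[of n] by (cases "n = 0") (auto simp: decr_W_eq compl_moment_def prob_space)
  ultimately show ?thesis
    by (simp add: decr_q_def)
qed

text \<open>The recursion sums from \<open>m = 1\<close>, whereas the binomial identities are about the full sum from
  \<open>m = 0\<close>; this is the conversion between the two.\<close>
lemma decr_W_times_sum_decr_q:
  assumes "n > 0"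
  shows "decr_W \<omega> n * (\<Sum>m=1..n. decr_q \<omega> n m * f m)
    = (\<Sum>m\<le>n. decr_w \<omega> n m * f m) - (1 - decr_W \<omega> n) * f 0"
proof -
  have "(\<Sum>m\<le>n. decr_w \<omega> n m * f m) = decr_w \<omega> n 0 * f 0 + (\<Sum>m=1..n. decr_w \<omega> n m * f m)"
    by (simp add: sum.atLeast_Suc_atMost[of 0] flip: atLeast0AtMost)
  then show ?thesis
    using decr_W_pos[OF assms]
    by (simp add: decr_q_def decr_W_def sum_distrib_left)
qed

lemma sum_decr_q: 
  assumes "n > 0"
  shows "(\<Sum>m=1..n. decr_q \<omega> n m) = 1"
proof -
  have "(\<Sum>m\<le>n. decr_w \<omega> n m) = (LINT x|\<omega>. (\<Sum>m\<le>n. real (n choose m) * x ^ m * (1 - x) ^ (n - m)))"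
    using sum_decr_w[of n "\<lambda>_. 1"] by (simp add: mult.assoc)
  also have "\<dots> = (LINT x|\<omega>. (x + (1 - x)) ^ n)"
    by (subst binomial_ring) simp
  finally show ?thesis
    using decr_W_times_sum_decr_q[OF assms, of "\<lambda>_. 1"] decr_W_pos[OF assms] by (simp add: prob_space)
qed

text \<open>The maximum principle: past \<open>N\<close>, each value of \<open>d\<close> is at most an average of earlier
  ones, so \<open>d\<close> never exceeds its largest value on \<open>{..N}\<close>.\<close>
lemma subharmonic_bounded_above:
  fixes d :: "nat \<Rightarrow> real"
  assumes "\<And>n. n \<ge> N \<Longrightarrow> d n \<le> (\<Sum>m=1..n. decr_q \<omega> n m * d (n - m))"
  shows "\<exists>C. \<forall>n. d n \<le> C"
proof -
  define C where "C = Max (d ` {..N})"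
  have "d n \<le> C" for n
  proof (induction n rule: less_induct)
    case (less n)
    show ?case
    proof (cases "n \<le> N")
      case True
      then show ?thesis
        unfolding C_def by (intro Max_ge) auto
    next
      case False
      then have "d n \<le> (\<Sum>m=1..n. decr_q \<omega> n m * d (n - m))"
        by (intro assms) auto
      also have "\<dots> \<le> (\<Sum>m=1..n. decr_q \<omega> n m * C)"
        using False by (intro sum_mono mult_left_mono less.IH decr_q_nonneg) auto
      also have "\<dots> = C"
        using sum_decr_q[of n] False by (simp flip: sum_distrib_right)
      finally show ?thesis .
    qed
  qed
  then show ?thesis
    by blast
qed

section \<open>The drift of the harmonic numbers\<close>

definition log_partial :: "nat \<Rightarrow> real" where
  "log_partial n = (LINT x|\<omega>. (\<Sum>k=1..n. x ^ k / real k))"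

text \<open>The transform of \<open>(1 - x) ^ k / k\<close> is
  \<open>\<Sum>k=1..n. (1 - x ^ k) / k\<close>, that is, \<open>harm n\<close> minus a partial sum of the series of
  \<open>- ln (1 - x)\<close>. So one step of the recursion loses that partial sum on average.\<close>
lemma harm_drift:
  assumes "n > 0"
  shows "harm n - (\<Sum>m=1..n. decr_q \<omega> n m * harm (n - m)) = log_partial n / decr_W \<omega> n"
proof -
  have harm: "harm n = binomial_transform (\<lambda>k. 1 / real k) n" for n
    using binomial_transform_power_div[of 1 n]
    by (simp add: harm_def inverse_eq_divide power_0_left)
  have "(\<Sum>m\<le>n. decr_w \<omega> n m * harm (n - m))
      = (LINT x|\<omega>. binomial_transform (\<lambda>k. (1 - x) ^ k / real k) n)"
    unfolding harm decr_w_binomial_transform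
    by (subst integral_binomial_transform) (auto simp: compl_moment_def)
  also have "\<dots> = (LINT x|\<omega>. harm n - (\<Sum>k=1..n. x ^ k / real k))"
    unfolding binomial_transform_power_div
    by (simp add: harm_def diff_divide_distrib sum_subtractf inverse_eq_divide)
  also have "\<dots> = harm n - log_partial n"
    by (subst Bochner_Integration.integral_diff) (auto simp: prob_space log_partial_def)
  finally have "(\<Sum>m\<le>n. decr_w \<omega> n m * harm (n - m)) = harm n - log_partial n" .
  with decr_W_times_sum_decr_q[OF assms, of "\<lambda>m. harm (n - m)"]
  have "decr_W \<omega> n * (harm n - (\<Sum>m=1..n. decr_q \<omega> n m * harm (n - m))) = log_partial n"
    by (simp add: algebra_simps)
  with decr_W_pos[OF assms] show ?thesis
    by (simp add: field_simps)
qed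

text \<open>All terms of the logarithmic series are nonnegative, so its sum dominates its partial
  sums; integrability of that sum is the hypothesis of finite logarithmic mean.\<close>
lemma log_partial_tendsto: "log_partial \<longlonglongrightarrow> log_mean \<omega>"
  unfolding log_partial_def[abs_def] log_mean_def
proof (rule integral_dominated_convergence[OF _ _ integrable_log])
  have sums: "(\<lambda>k. x ^ k / real k) sums \<bar>ln (1 - x)\<bar>" if "0 < x \<and> x < 1" for x :: real
    using ln_series'[of "- x"] that sums_minus by fastforce
  have eq: "(\<Sum>k=1..n. x ^ k / real k) = (\<Sum>k<Suc n. x ^ k / real k)" for x :: real and n
    by (simp add: lessThan_Suc_atMost sum.atLeast_Suc_atMost[of 0] flip: atLeast0AtMost)
  show "AE x in \<omega>. (\<lambda>n. \<Sum>k=1..n. x ^ k / real k) \<longlonglongrightarrow> \<bar>ln (1 - x)\<bar>"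
    using AE_unit
  proof eventually_elim
    case (elim x)
    then show ?case
      unfolding eq by (intro LIMSEQ_Suc sums[OF elim, unfolded sums_def])
  qed
  show "AE x in \<omega>. norm (\<Sum>k=1..n. x ^ k / real k) \<le> \<bar>ln (1 - x)\<bar>" for n
    using AE_unit
  proof eventually_elim
    case (elim x)
    have "norm (\<Sum>k=1..n. x ^ k / real k) = (\<Sum>k<Suc n. x ^ k / real k)"
      using elim unfolding eq[symmetric] by (subst real_norm_def, subst abs_of_nonneg) (auto intro!: sum_nonneg)
    also have "\<dots> \<le> \<bar>ln (1 - x)\<bar>"
      using sum_le_suminf[OF sums_summable[OF sums[OF elim]], of "{..<Suc n}"]
        sums_unique[OF sums[OF elim]] elim by auto
    finally show ?case .
  qed
qed measurable

lemma compl_moment_tendsto_0: "compl_moment \<longlonglongrightarrow> 0"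
proof -
  have "(\<lambda>n. LINT x|\<omega>. (1 - x) ^ n) \<longlonglongrightarrow> (LINT x|\<omega>. 0)"
  proof (rule integral_dominated_convergence[where w = "\<lambda>_. 1"])
    show "AE x in \<omega>. (\<lambda>n. (1 - x) ^ n) \<longlonglongrightarrow> 0"
      using AE_unit by eventually_elim (auto intro!: LIMSEQ_power_zero)
    show "AE x in \<omega>. norm ((1 - x) ^ n) \<le> 1" for n
      using AE_unit by eventually_elim (auto simp: power_abs intro!: power_le_one)
  qed auto
  then show ?thesis
    by (simp add: compl_moment_def[abs_def])
qed

lemma harm_drift_tendsto:
  "(\<lambda>n. harm n - (\<Sum>m=1..n. decr_q \<omega> n m * harm (n - m))) \<longlonglongrightarrow> log_mean \<omega>"
proof -
  have "(\<lambda>n. log_partial n / decr_W \<omega> n) \<longlonglongrightarrow> log_mean \<omega> / (1 - 0)"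
    unfolding decr_W_eq
    by (intro tendsto_intros log_partial_tendsto compl_moment_tendsto_0) auto
  then have "(\<lambda>n. log_partial n / decr_W \<omega> n) \<longlonglongrightarrow> log_mean \<omega>"
    by simp
  then show ?thesis
    by (rule Lim_transform_eventually)
       (rule eventually_mono[OF eventually_gt_at_top[of 0]], simp only: harm_drift)
qed

lemma log_mean_pos: "log_mean \<omega> > 0"
proof -
  have "(LINT x|\<omega>. 0) < log_mean \<omega>"
    unfolding log_mean_def
  proof (rule integral_less_AE_space)
    show "AE x in \<omega>. 0 < \<bar>ln (1 - x)\<bar>"
      using AE_unit by eventually_elim (auto simp: ln_eq_zero_iff)
  qed (auto simp: emeasure_space_1 integrable_log)
  then show ?thesis
    by simp
qed

text \<open>A solution has drift exactly 1, and \<open>c * harm\<close> has drift tending to \<open>c * \<mu>\<close>. If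
  \<open>c * \<mu> > 1\<close>, then \<open>a - c * harm\<close> eventually has negative drift and is bounded above by the maximum
  principle; if \<open>c * \<mu> < 1\<close>, the same holds for \<open>c * harm - a\<close>.\<close>
theorem recursion_asymp:
  fixes a :: "nat \<Rightarrow> real"
  assumes rec: "\<And>n. n \<ge> n0 \<Longrightarrow> a n = 1 + (\<Sum>m=1..n. decr_q \<omega> n m * a (n - m))"
  shows "a \<sim>[at_top] (\<lambda>n. ln (real n) / log_mean \<omega>)"
proof -
  define \<mu> where "\<mu> = log_mean \<omega>"
  have \<mu>: "\<mu> > 0"
    using log_mean_pos by (simp add: \<mu>_def)
  let ?D = "\<lambda>n. harm n - (\<Sum>m=1..n. decr_q \<omega> n m * harm (n - m)) :: real"
  \<comment> \<open>Taking \<open>s = 1\<close> or \<open>s = - 1\<close> covers both comparisons.\<close>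
  have step: "c * harm n + s * a n - (\<Sum>m=1..n. decr_q \<omega> n m * (c * harm (n - m) + s * a (n - m)))
      = c * ?D n + s" if "n \<ge> n0" for c s n
    using rec[OF that]
    by (simp add: algebra_simps sum.distrib flip: sum_distrib_left)
  have upper: "\<exists>C. \<forall>n. a n \<le> c * harm n + C" if "c * \<mu> > 1" for c
  proof -
    have "(\<lambda>n. c * ?D n) \<longlonglongrightarrow> c * \<mu>"
      unfolding \<mu>_def by (intro tendsto_intros harm_drift_tendsto)
    from order_tendstoD(1)[OF this that] obtain N where N: "\<And>n. n \<ge> N \<Longrightarrow> c * ?D n > 1"
      by (auto simp: eventually_sequentially)
    have "\<exists>C. \<forall>n. - c * harm n + 1 * a n \<le> C"
    proof (rule subharmonic_bounded_above[of "max N n0"])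
      fix n assume "n \<ge> max N n0"
      then show "- c * harm n + 1 * a n \<le> (\<Sum>m=1..n. decr_q \<omega> n m * (- c * harm (n - m) + 1 * a (n - m)))"
        using step[of n "- c" 1] N[of n] by simp
    qed
    then show ?thesis
      by (auto simp: algebra_simps)
  qed
  have lower: "\<exists>C. \<forall>n. c * harm n - C \<le> a n" if "c * \<mu> < 1" for c
  proof -
    have "(\<lambda>n. c * ?D n) \<longlonglongrightarrow> c * \<mu>"
      unfolding \<mu>_def by (intro tendsto_intros harm_drift_tendsto)
    from order_tendstoD(2)[OF this that] obtain N where N: "\<And>n. n \<ge> N \<Longrightarrow> c * ?D n < 1"
      by (auto simp: eventually_sequentially)
    have "\<exists>C. \<forall>n. c * harm n + (- 1) * a n \<le> C"
    proof (rule subharmonic_bounded_above[of "max N n0"])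
      fix n assume "n \<ge> max N n0"
      then show "c * harm n + (- 1) * a n \<le> (\<Sum>m=1..n. decr_q \<omega> n m * (c * harm (n - m) + (- 1) * a (n - m)))"
        using step[of n c "- 1"] N[of n] by simp
    qed
    then obtain C where "\<And>n. c * harm n + (- 1) * a n \<le> C"
      by blast
    then have "c * harm n - C \<le> a n" for n
      by (smt (verit))
    then show ?thesis
      by blast
  qed
  have const: "(\<lambda>n. c + C / harm n) \<longlonglongrightarrow> c" for c C :: real
  proof -
    have "(\<lambda>n. c + C / harm n) \<longlonglongrightarrow> c + 0"
      by (intro tendsto_add tendsto_const tendsto_divide_0)
         (auto intro!: filterlim_at_top_imp_at_infinity harm_at_top)
    then show ?thesis by simp
  qed
  have "(\<lambda>n. a n / harm n) \<longlonglongrightarrow> 1 / \<mu>"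
  proof (rule order_tendstoI)
    fix y assume "y < 1 / \<mu>"
    then obtain c where c: "y < c" "c < 1 / \<mu>"
      using dense by blast
    with \<mu> obtain C where C: "\<And>n. c * harm n - C \<le> a n"
      using lower[of c] by (auto simp: field_simps)
    have "eventually (\<lambda>n. y < c + (- C) / harm n) sequentially"
      by (rule order_tendstoD(1)[OF const c(1)])
    then show "eventually (\<lambda>n. y < a n / harm n) sequentially"
      using eventually_gt_at_top[of 0]
    proof eventually_elim
      case (elim n)
      have H: "harm n > (0 :: real)"
        using elim by (intro harm_pos)
      then have "c + (- C) / harm n = (c * harm n - C) / harm n"
        by (auto simp: diff_divide_distrib simp del: harm_pos_iff)
      also have "\<dots> \<le> a n / harm n"
        using H by (intro divide_right_mono C less_imp_le)
      finally have "c + (- C) / harm n \<le> a n / harm n" .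
      with elim show ?case by simp
    qed
  next
    fix y assume "1 / \<mu> < y"
    then obtain c where c: "c < y" "1 / \<mu> < c"
      using dense by blast
    with \<mu> obtain C where C: "\<And>n. a n \<le> c * harm n + C"
      using upper[of c] by (auto simp: field_simps)
    have "eventually (\<lambda>n. c + C / harm n < y) sequentially"
      by (rule order_tendstoD(2)[OF const c(1)])
    then show "eventually (\<lambda>n. a n / harm n < y) sequentially"
      using eventually_gt_at_top[of 0]
    proof eventually_elim
      case (elim n)
      have H: "harm n > (0 :: real)"
        using elim by (intro harm_pos)
      then have "a n / harm n \<le> (c * harm n + C) / harm n"
        by (intro divide_right_mono C less_imp_le)
      also have "\<dots> = c + C / harm n"
        using H by (auto simp: add_divide_distrib simp del: harm_pos_iff)
      finally have "a n / harm n \<le> c + C / harm n" .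
      with elim show ?case by simp
    qed
  qed
  from tendsto_mult[OF tendsto_mult[OF this harm_over_ln_tendsto] tendsto_const[of \<mu>]]
  have "(\<lambda>n. a n / harm n * (harm n / ln (real n)) * \<mu>) \<longlonglongrightarrow> 1"
    using \<mu> by simp
  then have "(\<lambda>n. a n / (ln (real n) / \<mu>)) \<longlonglongrightarrow> 1"
  proof (rule Lim_transform_eventually)
    show "\<forall>\<^sub>F n in sequentially.
        a n / harm n * (harm n / ln (real n)) * \<mu> = a n / (ln (real n) / \<mu>)"
      using eventually_gt_at_top[of 0]
    proof eventually_elim
      case (elim n)
      then have "harm n \<noteq> (0 :: real)"
        using harm_pos[of n, where ?'a = real] by linarith
      then show ?case
        by simp
    qed
  qed
  then show ?thesis
    unfolding \<mu>_def by (rule asymp_equivI')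
qed

section \<open>The mean number of parts as a solution\<close>

text \<open>The closed form of the mean number of parts; its probabilistic meaning is lemma
  \<open>expectation_stick_K\<close> below. Term \<open>k\<close> is the sum of the geometric series
  \<open>\<Sum>j. moment k * compl_moment k ^ j\<close>.\<close>
definition mean_parts :: "nat \<Rightarrow> real" where
  "mean_parts n = binomial_transform (\<lambda>k. moment k / (1 - compl_moment k)) n"

text \<open>Since the averaging operator multiplies term \<open>k\<close> by \<open>compl_moment k\<close>, subtracting it cancels the
  denominators and leaves the transform of the moments, which is
  \<open>\<integral> (1 - (1 - x) ^ n) \<omega>(dx) = decr_W \<omega> n\<close>.\<close>
lemma mean_parts_recursion:
  assumes "n > 0"
  shows "mean_parts n = 1 + (\<Sum>m=1..n. decr_q \<omega> n m * mean_parts (n - m))"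
proof -
  have "mean_parts n - (\<Sum>m\<le>n. decr_w \<omega> n m * mean_parts (n - m)) = binomial_transform moment n"
    unfolding mean_parts_def decr_w_binomial_transform
    unfolding binomial_transform_def sum_subtractf[symmetric]
  proof (intro sum.cong refl)
    fix k assume "k \<in> {1..n}"
    then have "1 - compl_moment k \<noteq> 0"
      using compl_moment_less_1[of k] by simp
    then have "moment k = (1 - compl_moment k) * (moment k / (1 - compl_moment k))"
      by simp
    then have "moment k = moment k / (1 - compl_moment k) - compl_moment k * (moment k / (1 - compl_moment k))"
      by (simp only: left_diff_distrib mult_1_left)
    then show "(-1) ^ (k + 1) * real (n choose k) * (moment k / (1 - compl_moment k))
        - (-1) ^ (k + 1) * real (n choose k) * (compl_moment k * (moment k / (1 - compl_moment k)))
        = (-1) ^ (k + 1) * real (n choose k) * moment k"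
      by (metis right_diff_distrib)
  qed
  also have "binomial_transform moment n = decr_W \<omega> n"
  proof -
    have "binomial_transform moment n = (LINT x|\<omega>. 1 - (1 - x) ^ n)"
      unfolding moment_def[abs_def] binomial_transform_power[symmetric]
      by (rule integral_binomial_transform[symmetric]) simp
    then show ?thesis
      by (simp add: decr_W_eq compl_moment_def prob_space)
  qed
  finally have "decr_W \<omega> n * mean_parts n
      = decr_W \<omega> n * (1 + (\<Sum>m=1..n. decr_q \<omega> n m * mean_parts (n - m)))"
    using decr_W_times_sum_decr_q[OF assms, of "\<lambda>m. mean_parts (n - m)"]
    by (simp add: algebra_simps)
  then show ?thesis
    using decr_W_pos[OF assms] by simp
qed

lemma recursion_unique:
  fixes a b :: "nat \<Rightarrow> real"
  assumes "a 0 = b 0"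
    and "\<And>n. n > 0 \<Longrightarrow> a n = 1 + (\<Sum>m=1..n. decr_q \<omega> n m * a (n - m))"
    and "\<And>n. n > 0 \<Longrightarrow> b n = 1 + (\<Sum>m=1..n. decr_q \<omega> n m * b (n - m))"
  shows "a = b"
proof
  fix n
  show "a n = b n"
  proof (induction n rule: less_induct)
    case (less n)
    show ?case
    proof (cases "n = 0")
      case False
      then have "(\<Sum>m=1..n. decr_q \<omega> n m * a (n - m)) = (\<Sum>m=1..n. decr_q \<omega> n m * b (n - m))"
        by (intro sum.cong refl) (simp add: less.IH)
      then show ?thesis
        using assms(2)[of n] assms(3)[of n] False by simp
    qed (simp add: assms(1))
  qed
qed

end

section \<open>The stick-breaking process\<close>

locale stick_process = law: stick_law \<omega> for \<omega> :: "real measure" +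
  fixes M :: "'b measure" and X U :: "nat \<Rightarrow> 'b \<Rightarrow> real"
  assumes model: "stick_model \<omega> M X U"

sublocale stick_process \<subseteq> prob_space M
  using model by (simp add: stick_model_def)

context stick_process
begin

lemma indep: "indep_vars (\<lambda>_. borel) (case_sum X U) ({1..} <+> {1..})"
  using model by (simp add: stick_model_def)

lemma distr_X: "1 \<le> j \<Longrightarrow> distr M borel (X j) = \<omega>"
  using model by (simp add: stick_model_def)

lemma distr_U: "1 \<le> i \<Longrightarrow> distr M borel (U i) = uniform_measure lborel {0..1}"
  using model by (simp add: stick_model_def)

lemma measurable_X [measurable (raw)]: "1 \<le> j \<Longrightarrow> X j \<in> borel_measurable M"
  using indep[unfolded indep_vars_def2, THEN conjunct1, rule_format, of "Inl j"] by auto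

lemma measurable_U [measurable (raw)]: "1 \<le> i \<Longrightarrow> U i \<in> borel_measurable M"
  using indep[unfolded indep_vars_def2, THEN conjunct1, rule_format, of "Inr i"] by auto

lemma AE_X: "AE s in M. \<forall>j\<ge>1. 0 < X j s \<and> X j s < 1"
proof -
  have "AE s in M. 1 \<le> j \<longrightarrow> 0 < X j s \<and> X j s < 1" for j
  proof (cases "1 \<le> j")
    case True
    have "AE x in distr M borel (X j). 0 < x \<and> x < 1"
      unfolding distr_X[OF True] by (rule law.AE_unit)
    then show ?thesis
      by (subst (asm) AE_distr_iff) (use measurable_X[OF True] in auto)
  qed simp
  then show ?thesis
    by (simp add: AE_all_countable)
qed

definition gap :: "nat \<Rightarrow> 'b \<Rightarrow> real" where
  "gap j s = X j s * (\<Prod>i=1..j-1. 1 - X i s)"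

lemma gap_eq:
  assumes "1 \<le> j"
  shows "gap j s = stick_P X j s - stick_P X (j - 1) s"
proof -
  obtain l where j: "j = Suc l" using assms by (cases j) auto
  show ?thesis
    unfolding j gap_def stick_P_def by (simp add: algebra_simps)
qed

lemma measurable_stick_P [measurable]: "stick_P X j \<in> borel_measurable M"
  unfolding stick_P_def[abs_def] by measurable

lemma measurable_gap [measurable (raw)]:
  assumes "1 \<le> j"
  shows "gap j \<in> borel_measurable M"
proof -
  have "gap j = (\<lambda>s. stick_P X j s - stick_P X (j - 1) s)"
    using gap_eq[OF assms] by (rule ext)
  then show ?thesis
    by simp
qed

lemma stick_P_bounds:
  assumes "\<forall>j\<ge>1. 0 < X j s \<and> X j s < 1"
  shows "0 \<le> stick_P X j s" "stick_P X j s \<le> 1" "1 \<le> j \<Longrightarrow> stick_P X (j - 1) s \<le> stick_P X j s"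
proof -
  have bd: "0 \<le> 1 - X i s" "1 - X i s \<le> 1" if "1 \<le> i" for i
    using assms that by force+
  show "0 \<le> stick_P X j s"
    unfolding stick_P_def using bd by (auto intro!: prod_le_1)
  show "stick_P X j s \<le> 1"
    unfolding stick_P_def using bd by (auto intro!: prod_nonneg)
  have "0 \<le> gap j s" if "1 \<le> j"
    unfolding gap_def using bd assms that by (intro mult_nonneg_nonneg prod_nonneg) (auto intro: less_imp_le)
  then show "1 \<le> j \<Longrightarrow> stick_P X (j - 1) s \<le> stick_P X j s"
    using gap_eq by simp
qed

lemma gap_bounds:
  assumes "\<forall>j\<ge>1. 0 < X j s \<and> X j s < 1" "1 \<le> j"
  shows "0 \<le> gap j s" "gap j s \<le> 1"
  using stick_P_bounds[OF assms(1)] gap_eq[OF assms(2)] assms(2)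
  by (smt (verit))+

lemma integrable_gap_power:
  assumes j: "1 \<le> j"
  shows "integrable M (\<lambda>s. gap j s ^ k)" and "integrable M (\<lambda>s. (1 - gap j s) ^ k)"
proof -
  have bounds: "AE s in M. 0 \<le> gap j s \<and> gap j s \<le> 1"
    using AE_X by eventually_elim (use gap_bounds[OF _ j] in blast)
  note [measurable] = measurable_gap[OF j]
  show "integrable M (\<lambda>s. gap j s ^ k)"
    by (rule integrable_const_bound[where B = 1], use bounds in eventually_elim)
       (auto simp: power_abs intro!: power_le_one)
  show "integrable M (\<lambda>s. (1 - gap j s) ^ k)"
    by (rule integrable_const_bound[where B = 1], use bounds in eventually_elim)
       (auto simp: power_abs intro!: power_le_one)
qed

text \<open>The \<open>k\<close>-th power of the gap is a product of functions of the independent variables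
  \<open>X 1, \<dots>, X j\<close>: the first \<open>j - 1\<close> contribute a factor \<open>compl_moment k\<close> each, the last
  one contributes \<open>moment k\<close>.\<close>
lemma expectation_gap_power:
  assumes "1 \<le> j"
  shows "expectation (\<lambda>s. gap j s ^ k) = law.moment k * law.compl_moment k ^ (j - 1)"
proof -
  define Y :: "nat \<Rightarrow> real \<Rightarrow> real" where
    "Y i x = (if i = j then x ^ k else (1 - x) ^ k)" for i x
  \<comment> \<open>The independent family of the model is indexed by \<open>nat + nat\<close>; the components \<open>Inr i\<close> get a
     dummy value, as the product runs over \<open>Inl\<close> indices.\<close>
  define Z :: "nat + nat \<Rightarrow> 'b \<Rightarrow> real" where
    "Z p s = case_sum Y (\<lambda>_ _. 0) p (case_sum X U p s)" for p s
  have Y [measurable]: "Y i \<in> borel_measurable borel" for i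
    unfolding Y_def by measurable
  have int: "integrable \<omega> (Y i)" for i
    by (cases "i = j") (auto simp: Y_def[abs_def])
  have "indep_vars (\<lambda>_. borel) (case_sum X U) (Inl ` {1..j})"
    by (rule indep_vars_subset[OF indep]) auto
  then have ind: "indep_vars (\<lambda>_. borel) Z (Inl ` {1..j})"
    unfolding Z_def by (rule indep_vars_compose2) auto
  have "gap j s ^ k = (\<Prod>p\<in>Inl ` {1..j}. Z p s)" for s
  proof -
    obtain l where j: "j = Suc l" using assms by (cases j) auto
    have "(\<Prod>p\<in>Inl ` {1..j}. Z p s) = (\<Prod>i=1..j. Y i (X i s))"
      by (subst prod.reindex) (auto simp: Z_def)
    also have "\<dots> = (\<Prod>i=1..l. (1 - X i s) ^ k) * X j s ^ k"
      unfolding j by (simp add: Y_def j)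
    finally show ?thesis
      by (simp add: gap_def j power_mult_distrib prod_power_distrib)
  qed
  then have "expectation (\<lambda>s. gap j s ^ k) = expectation (\<lambda>s. \<Prod>p\<in>Inl ` {1..j}. Z p s)"
    by simp
  also have "\<dots> = (\<Prod>p\<in>Inl ` {1..j}. expectation (Z p))"
  proof (rule indep_vars_lebesgue_integral[OF _ ind])
    fix p :: "nat + nat" assume "p \<in> Inl ` {1..j}"
    then obtain i where i: "p = Inl i" "1 \<le> i" by auto
    show "integrable M (Z p)"
      using int[of i] unfolding distr_X[OF i(2), symmetric]
      by (subst (asm) integrable_distr_eq) (auto simp: i(1) Z_def[abs_def] measurable_X[OF i(2)])
  qed simp
  also have "\<dots> = (\<Prod>i=1..j. expectation (Z (Inl i)))"
    by (subst prod.reindex) auto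
  also have "\<dots> = (\<Prod>i=1..j. LINT x|\<omega>. Y i x)"
  proof (rule prod.cong)
    fix i assume "i \<in> {1..j}"
    then have i: "1 \<le> i" by simp
    show "expectation (Z (Inl i)) = (LINT x|\<omega>. Y i x)"
      unfolding distr_X[OF i, symmetric]
      by (subst integral_distr) (auto simp: Z_def[abs_def] measurable_X[OF i])
  qed simp
  also have "\<dots> = law.moment k * law.compl_moment k ^ (j - 1)"
  proof -
    obtain l where j: "j = Suc l" using assms by (cases j) auto
    show ?thesis
      unfolding j by (simp add: Y_def j law.moment_def law.compl_moment_def)
  qed
  finally show ?thesis .
qed

definition hit :: "nat \<Rightarrow> nat \<Rightarrow> 'b set" where
  "hit n j = {s \<in> space M. \<exists>i\<in>{1..n}. U i s \<in> {stick_P X (j - 1) s <..< stick_P X j s}}"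

lemma sets_hit [measurable]: "hit n j \<in> events"
  unfolding hit_def greaterThanLessThan_iff by measurable

lemma uniform_outside:
  assumes "0 \<le> p" "p \<le> q" "q \<le> 1"
  shows "emeasure (uniform_measure lborel {0..1::real}) (- {p<..<q}) = ennreal (1 - (q - p))"
proof -
  interpret u: prob_space "uniform_measure lborel {0..1::real}"
    by (rule prob_space_uniform_measure) auto
  have "{0..1} \<inter> {p<..<q} = {p<..<q}"
    using assms by auto
  then have "u.prob {p<..<q} = q - p"
    using assms by (subst measure_uniform_measure) auto
  then show ?thesis
    using u.prob_compl[of "{p<..<q}"]
    by (simp add: u.emeasure_eq_measure Compl_eq_Diff_UNIV)
qed

text \<open>The sticks and the uniform points are independent, so the probability can be computed by
  first fixing the sticks: each point then misses the \<open>j\<close>-th interval with probability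
  \<open>1 - gap j\<close>, independently of the others. The conditioning is Fubini's theorem for the product
  of the joint law of \<open>X 1, \<dots>, X j\<close> with the joint law of \<open>U 1, \<dots>, U n\<close>.\<close>
lemma prob_missed:
  assumes j: "1 \<le> j"
  shows "prob (space M - hit n j) = expectation (\<lambda>s. (1 - gap j s) ^ n)"
proof (cases "n = 0")
  case True
  then show ?thesis
    by (simp add: hit_def prob_space)
next
  case False
  define u where "u = uniform_measure lborel {0..1::real}"
  interpret u: prob_space u
    unfolding u_def by (rule prob_space_uniform_measure) auto
  have sets_u [simp, measurable_cong]: "sets u = sets borel"
    by (simp add: u_def)
  define A :: "(nat + nat) set" where "A = Inl ` {1..j}"
  define B :: "(nat + nat) set" where "B = Inr ` {1..n}"
  have B: "finite B" "B \<noteq> {}" "card B = n"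
    using False by (auto simp: B_def card_image)
  interpret PB: product_prob_space "\<lambda>_ :: nat + nat. u" B ..
  \<comment> \<open>\<open>Q l\<close> is the endpoint \<open>stick_P X l\<close> as a function of the stick coordinates.\<close>
  define Q :: "nat \<Rightarrow> (nat + nat \<Rightarrow> real) \<Rightarrow> real" where
    "Q l f = 1 - (\<Prod>i=1..l. 1 - f (Inl i))" for l f
  have Q: "Q l \<in> borel_measurable (PiM A (\<lambda>_. borel))" if "l \<le> j" for l
    unfolding Q_def[abs_def] using that
    by (auto intro!: borel_measurable_prod borel_measurable_diff measurable_component_singleton simp: A_def)
  note [measurable] = Q[OF diff_le_self] Q[OF order_refl]
  define Z where "Z s = (\<lambda>p\<in>A. case_sum X U p s)" for s
  define V where "V s = (\<lambda>p\<in>B. case_sum X U p s)" for s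
  have QZ: "Q l (Z s) = stick_P X l s" if "l \<le> j" for l s
    using that by (auto simp: Z_def Q_def A_def stick_P_def intro!: prod.cong)
  have ZV: "indep_var (PiM A (\<lambda>_. borel)) Z (PiM B (\<lambda>_. borel)) V"
    unfolding Z_def V_def by (rule indep_var_restrict[OF indep]) (auto simp: A_def B_def)
  have measZ [measurable]: "Z \<in> M \<rightarrow>\<^sub>M PiM A (\<lambda>_. borel)"
    and measV [measurable]: "V \<in> M \<rightarrow>\<^sub>M PiM B (\<lambda>_. borel)"
    using indep_var_rv1[OF ZV] indep_var_rv2[OF ZV] by auto
  have distrV: "distr M (PiM B (\<lambda>_. borel)) V = PiM B (\<lambda>_. u)"
  proof -
    have "indep_vars (\<lambda>_. borel) (case_sum X U) B"
      by (rule indep_vars_subset[OF indep]) (auto simp: B_def)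
    then have "distr M (PiM B (\<lambda>_. borel)) V = PiM B (\<lambda>p. distr M borel (case_sum X U p))"
      unfolding V_def
      by (subst (asm) indep_vars_iff_distr_eq_PiM'[OF B(2)]) (auto simp: B_def measurable_U)
    also have "\<dots> = PiM B (\<lambda>_. u)"
      by (rule PiM_cong) (auto simp: B_def distr_U u_def)
    finally show ?thesis .
  qed
  define E where "E = {(f, v) \<in> space (PiM A (\<lambda>_. borel) \<Otimes>\<^sub>M PiM B (\<lambda>_. u)).
      \<forall>p\<in>B. v p \<notin> {Q (j - 1) f<..<Q j f}}"
  have E [measurable]: "E \<in> sets (PiM A (\<lambda>_. borel) \<Otimes>\<^sub>M PiM B (\<lambda>_. u))"
  proof -
    let ?N = "PiM A (\<lambda>_. borel) \<Otimes>\<^sub>M PiM B (\<lambda>_. u)"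
    have "{x \<in> space ?N. Q (j - 1) (fst x) < snd x p \<and> snd x p < Q j (fst x)} \<in> sets ?N"
      if "p \<in> B" for p
    proof -
      have [measurable]: "(\<lambda>x. snd x p) \<in> borel_measurable ?N"
        using measurable_component_singleton[OF that, of "\<lambda>_. u"]
        by (intro measurable_compose[OF measurable_snd])
           (simp add: measurable_cong_sets[OF refl sets_u])
      show ?thesis
        by measurable
    qed
    then have "space ?N - (\<Union>p\<in>B. {x \<in> space ?N. Q (j - 1) (fst x) < snd x p \<and> snd x p < Q j (fst x)}) \<in> sets ?N"
      using B(1) by blast
    also have "space ?N - (\<Union>p\<in>B. {x \<in> space ?N. Q (j - 1) (fst x) < snd x p \<and> snd x p < Q j (fst x)}) = E"
      by (auto simp: E_def)
    finally show ?thesis .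
  qed
  have slice: "emeasure (PiM B (\<lambda>_. u)) (Pair f -` E) = ennreal ((1 - (q - p)) ^ n)"
    if "f \<in> space (PiM A (\<lambda>_. borel))" "Q (j - 1) f = p" "Q j f = q" "0 \<le> p" "p \<le> q" "q \<le> 1"
    for p q f
  proof -
    have "Pair f -` E = {v \<in> space (PiM B (\<lambda>_. u)). \<forall>i\<in>B. v i \<in> - {p<..<q}}"
      using that by (auto simp: E_def space_pair_measure)
    also have "emeasure (PiM B (\<lambda>_. u)) \<dots> = (\<Prod>i\<in>B. emeasure u (- {p<..<q}))"
      by (rule PB.emeasure_PiM_Collect) (auto simp: B)
    also have "\<dots> = ennreal ((1 - (q - p)) ^ n)"
      unfolding u_def using that by (subst uniform_outside) (auto simp: B ennreal_power)
    finally show ?thesis .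
  qed
  have "emeasure M (space M - hit n j) = emeasure (distr M (PiM A (\<lambda>_. borel) \<Otimes>\<^sub>M PiM B (\<lambda>_. borel)) (\<lambda>s. (Z s, V s))) E"
  proof (subst emeasure_distr)
    show "E \<in> sets (PiM A (\<lambda>_. borel) \<Otimes>\<^sub>M PiM B (\<lambda>_. borel))"
      using E sets_pair_measure_cong[OF refl sets_PiM_cong[OF refl sets_u]] by blast
    have "space M - hit n j = (\<lambda>s. (Z s, V s)) -` E \<inter> space M"
      using measurable_space[OF measV] measurable_space[OF measZ]
      by (auto simp: E_def hit_def QZ V_def B_def space_pair_measure space_PiM u_def)
    then show "emeasure M (space M - hit n j) = emeasure M ((\<lambda>s. (Z s, V s)) -` E \<inter> space M)"
      by simp
  qed measurable
  also have "\<dots> = emeasure (distr M (PiM A (\<lambda>_. borel)) Z \<Otimes>\<^sub>M PiM B (\<lambda>_. u)) E"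
    using ZV unfolding indep_var_distribution_eq distrV by simp
  also have "\<dots> = (\<integral>\<^sup>+z. emeasure (PiM B (\<lambda>_. u)) (Pair z -` E) \<partial>distr M (PiM A (\<lambda>_. borel)) Z)"
    by (rule PB.emeasure_pair_measure_alt) (use E in \<open>simp cong: sets_pair_measure_cong\<close>)
  also have "\<dots> = (\<integral>\<^sup>+s. emeasure (PiM B (\<lambda>_. u)) (Pair (Z s) -` E) \<partial>M)"
    by (rule nn_integral_distr[OF measZ]) (use PB.measurable_emeasure_Pair[OF E] in simp)
  also have "\<dots> = (\<integral>\<^sup>+s. ennreal ((1 - gap j s) ^ n) \<partial>M)"
  proof (rule nn_integral_cong_AE, use AE_X AE_space in eventually_elim)
    case (elim s)
    then show ?case
      using slice[OF measurable_space[OF measZ] QZ QZ, of s] stick_P_bounds[of s] j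
      by (simp add: gap_eq)
  qed
  also have "\<dots> = ennreal (expectation (\<lambda>s. (1 - gap j s) ^ n))"
  proof (rule nn_integral_eq_integral)
    show "integrable M (\<lambda>s. (1 - gap j s) ^ n)"
      by (rule integrable_gap_power[OF j])
    show "AE s in M. 0 \<le> (1 - gap j s) ^ n"
      using AE_X by eventually_elim (use gap_bounds[OF _ j] in auto)
  qed
  finally show ?thesis
    unfolding emeasure_eq_measure
    by (subst (asm) ennreal_inj) (auto intro!: integral_nonneg_AE, use AE_X in eventually_elim, use gap_bounds[OF _ j] in auto)
qed

text \<open>The complementary probability \<open>1 - (1 - gap j) ^ n\<close> is the transform of the powers of the
  gap, whose means are known.\<close>
lemma prob_hit:
  assumes j: "1 \<le> j"
  shows "prob (hit n j) = binomial_transform (\<lambda>k. law.moment k * law.compl_moment k ^ (j - 1)) n"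
proof -
  have "prob (hit n j) = 1 - expectation (\<lambda>s. (1 - gap j s) ^ n)"
    using prob_missed[OF j, of n] prob_compl[OF sets_hit, of n j] by simp
  also have "\<dots> = expectation (\<lambda>s. binomial_transform (\<lambda>k. gap j s ^ k) n)"
    unfolding binomial_transform_power using integrable_gap_power[OF j] by (simp add: prob_space)
  also have "\<dots> = binomial_transform (\<lambda>k. expectation (\<lambda>s. gap j s ^ k)) n"
    using integrable_gap_power[OF j] unfolding binomial_transform_def by (subst Bochner_Integration.integral_sum) auto
  finally show ?thesis
    by (simp add: expectation_gap_power[OF j])
qed

text \<open>The sum runs over \<open>Suc l\<close> because the intervals are numbered from 1; term by term in
  \<open>k\<close> it is a geometric series with ratio \<open>compl_moment k < 1\<close>.\<close>
lemma prob_hit_sums: "(\<lambda>l. prob (hit n (Suc l))) sums law.mean_parts n"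
proof -
  have eq: "prob (hit n (Suc l))
      = binomial_transform (\<lambda>k. law.moment k * law.compl_moment k ^ (Suc l - 1)) n" for l
    by (rule prob_hit) simp
  show ?thesis
    unfolding eq law.mean_parts_def binomial_transform_def
  proof (rule sums_sum)
    fix k assume "k \<in> {1..n}"
    then have "norm (law.compl_moment k) < 1"
      using law.compl_moment_less_1[of k] law.compl_moment_nonneg[of k] by simp
    from sums_mult[OF geometric_sums[OF this], of "(-1) ^ (k + 1) * real (n choose k) * law.moment k"]
    show "(\<lambda>l. (-1) ^ (k + 1) * real (n choose k) * (law.moment k * law.compl_moment k ^ (Suc l - 1)))
        sums ((-1) ^ (k + 1) * real (n choose k) * (law.moment k / (1 - law.compl_moment k)))"
      by (simp add: mult.assoc)
  qed
qed

lemma measurable_stick_K [measurable]: "(\<lambda>s. real (stick_K X U n s)) \<in> borel_measurable M"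
proof -
  have "(\<lambda>s. stick_K X U n s) \<in> M \<rightarrow>\<^sub>M count_space UNIV"
    unfolding stick_K_def
  proof (rule measurable_card)
    fix j
    have "{s \<in> space M. j \<in> {j. 1 \<le> j \<and> (\<exists>i\<in>{1..n}. U i s \<in> {stick_P X (j - 1) s<..<stick_P X j s})}}
        = (if 1 \<le> j then hit n j else {})"
      by (auto simp: hit_def)
    then show "{s \<in> space M. j \<in> {j. 1 \<le> j \<and> (\<exists>i\<in>{1..n}. U i s \<in> {stick_P X (j - 1) s<..<stick_P X j s})}} \<in> events"
      by (simp add: sets_hit)
  qed
  then show ?thesis
    by measurable
qed

text \<open>The hitting probabilities are summable, so by the Borel-Cantelli lemma only finitely many
  intervals are hit almost surely. Only then does \<open>card\<close>, which is 0 on infinite sets, agree with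
  the sum of the indicators.\<close>
lemma AE_stick_K_sums: 
  "AE s in M. (\<lambda>l. indicat_real (hit n (Suc l)) s) sums real (stick_K X U n s)"
proof -
  have "AE s in M. eventually (\<lambda>l. s \<in> space M - hit n (Suc l)) sequentially"
    by (rule borel_cantelli_AE1) (auto simp: emeasure_eq_measure intro: sums_summable[OF prob_hit_sums])
  then show ?thesis
  proof eventually_elim
    case (elim s)
    then obtain N where N: "\<And>l. l \<ge> N \<Longrightarrow> s \<in> space M \<and> s \<notin> hit n (Suc l)"
      by (auto simp: eventually_sequentially)
    then have s: "s \<in> space M" by blast
    define S where "S = {l. s \<in> hit n (Suc l)}"
    have "S \<subseteq> {..<N}"
      unfolding S_def using N by (auto simp flip: not_le)
    then have "finite S"
      using finite_subset by blast
    then have "(\<lambda>l. indicat_real (hit n (Suc l)) s) sums (\<Sum>l\<in>S. indicat_real (hit n (Suc l)) s)"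
      by (rule sums_finite) (auto simp: S_def)
    moreover have "(\<Sum>l\<in>S. indicat_real (hit n (Suc l)) s) = real (card S)"
      by (simp add: S_def)
    moreover have "{j. 1 \<le> j \<and> (\<exists>i\<in>{1..n}. U i s \<in> {stick_P X (j - 1) s<..<stick_P X j s})} = Suc ` S"
    proof -
      have "j \<in> Suc ` S \<longleftrightarrow> 1 \<le> j \<and> s \<in> hit n j" for j
        by (cases j) (auto simp: S_def)
      then show ?thesis
        using s by (auto simp: hit_def)
    qed
    then have "stick_K X U n s = card S"
      unfolding stick_K_def by (simp add: card_image)
    ultimately show ?case
      by simp
  qed
qed

lemma
  shows integrable_stick_K: "integrable M (\<lambda>s. real (stick_K X U n s))"
    and expectation_stick_K: "expectation (\<lambda>s. real (stick_K X U n s)) = law.mean_parts n"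
proof -
  let ?f = "\<lambda>l s. indicat_real (hit n (Suc l)) s"
  have int: "integrable M (?f l)" for l
    by (simp add: emeasure_eq_measure)
  have sm: "AE s in M. summable (\<lambda>l. norm (?f l s))"
    using AE_stick_K_sums[of n] by eventually_elim (auto dest: sums_summable)
  have ssm: "summable (\<lambda>l. expectation (\<lambda>s. norm (?f l s)))"
    using sums_summable[OF prob_hit_sums[of n]] by simp
  have eq: "AE s in M. (\<Sum>l. ?f l s) = real (stick_K X U n s)"
    using AE_stick_K_sums[of n] by eventually_elim (simp add: sums_iff)
  have "integrable M (\<lambda>s. \<Sum>l. ?f l s)"
    by (rule integrable_suminf[OF int sm ssm])
  then show "integrable M (\<lambda>s. real (stick_K X U n s))"
    by (rule integrable_cong_AE_imp) (use eq in auto)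
  have "expectation (\<lambda>s. real (stick_K X U n s)) = expectation (\<lambda>s. \<Sum>l. ?f l s)"
    by (rule integral_cong_AE) (use eq in auto)
  also have "\<dots> = (\<Sum>l. expectation (?f l))"
    by (rule integral_suminf[OF int sm ssm])
  also have "\<dots> = law.mean_parts n"
    using sums_unique[OF prob_hit_sums[of n]] by simp
  finally show "expectation (\<lambda>s. real (stick_K X U n s)) = law.mean_parts n" .
qed

end

theorem proposition2:
  fixes \<omega> :: "real measure"
  assumes "prob_space \<omega>" and "sets \<omega> = sets borel" and "measure \<omega> {0<..<1} = 1"
    and "integrable \<omega> (\<lambda>x. \<bar>ln (1 - x)\<bar>)"
  shows "(\<forall>n0\<ge>1. \<forall>a :: nat \<Rightarrow> real.
            (\<forall>n\<ge>n0. a n = 1 + (\<Sum>m=1..n. decr_q \<omega> n m * a (n - m))) \<longrightarrow>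
            a \<sim>[at_top] (\<lambda>n. ln (real n) / log_mean \<omega>)) \<and>
         (\<forall>(M :: 'b measure) X U. stick_model \<omega> M X U \<longrightarrow>
            (\<forall>n. integrable M (\<lambda>s. real (stick_K X U n s))) \<and>
            (\<forall>a :: nat \<Rightarrow> real.
               a 0 = 0 \<and> (\<forall>n>0. a n = 1 + (\<Sum>m=1..n. decr_q \<omega> n m * a (n - m))) \<longleftrightarrow>
               a = (\<lambda>n. LINT s|M. real (stick_K X U n s))) \<and>
            (\<lambda>n. LINT s|M. real (stick_K X U n s)) \<sim>[at_top] (\<lambda>n. ln (real n) / log_mean \<omega>))"
proof -
  interpret law: stick_law \<omega>
    using assms by (auto simp: stick_law_def stick_law_axioms_def)
  have asymp: "a \<sim>[at_top] (\<lambda>n. ln (real n) / log_mean \<omega>)"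
    if "\<forall>n\<ge>n0. a n = 1 + (\<Sum>m=1..n. decr_q \<omega> n m * a (n - m))" for n0 and a :: "nat \<Rightarrow> real"
    using that by (intro law.recursion_asymp[of n0]) blast
  have mean_0: "law.mean_parts 0 = 0"
    by (simp add: law.mean_parts_def binomial_transform_def)
  have unique: "a 0 = 0 \<and> (\<forall>n>0. a n = 1 + (\<Sum>m=1..n. decr_q \<omega> n m * a (n - m))) \<longleftrightarrow> a = law.mean_parts" for a
  proof
    assume "a 0 = 0 \<and> (\<forall>n>0. a n = 1 + (\<Sum>m=1..n. decr_q \<omega> n m * a (n - m)))"
    then show "a = law.mean_parts"
      using mean_0 law.mean_parts_recursion by (intro law.recursion_unique) auto
  next
    assume "a = law.mean_parts"
    then show "a 0 = 0 \<and> (\<forall>n>0. a n = 1 + (\<Sum>m=1..n. decr_q \<omega> n m * a (n - m)))"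
      using mean_0 law.mean_parts_recursion by blast
  qed
  have mean_asymp: "law.mean_parts \<sim>[at_top] (\<lambda>n. ln (real n) / log_mean \<omega>)"
    by (rule asymp[of 1]) (use law.mean_parts_recursion in auto)
  show ?thesis
  proof (intro conjI allI impI)
    fix n0 :: nat and a :: "nat \<Rightarrow> real"
    assume "\<forall>n\<ge>n0. a n = 1 + (\<Sum>m=1..n. decr_q \<omega> n m * a (n - m))"
    then show "a \<sim>[at_top] (\<lambda>n. ln (real n) / log_mean \<omega>)"
      by (rule asymp)
  next
    fix M :: "'b measure" and X U
    assume "stick_model \<omega> M X U"
    then interpret stick_process \<omega> M X U
      by unfold_locales
    show "integrable M (\<lambda>s. real (stick_K X U n s))" for n
      by (rule integrable_stick_K)
    have mean: "(\<lambda>n. LINT s|M. real (stick_K X U n s)) = law.mean_parts"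
      by (rule ext) (rule expectation_stick_K)
    show "(a 0 = 0 \<and> (\<forall>n>0. a n = 1 + (\<Sum>m=1..n. decr_q \<omega> n m * a (n - m)))) =
        (a = (\<lambda>n. LINT s|M. real (stick_K X U n s)))" for a :: "nat \<Rightarrow> real"
      unfolding mean by (rule unique)
    show "(\<lambda>n. LINT s|M. real (stick_K X U n s)) \<sim>[at_top] (\<lambda>n. ln (real n) / log_mean \<omega>)"
      unfolding mean by (rule mean_asymp)
  qed
qed

end
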